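(* Call two exact acoustic analogies $A_1=(L_1,\varphi_1,s_1)$ and $A_2=(L_2,\varphi_2,s_2)$ on-shell far-field equivalent if, for every solution $q$ of the compressible Navier--Stokes equations in the class considered, the far-field traces of $\varphi_1(q)$ and $\varphi_2(q)$ coincide. Then all exact analogies are on-shell far-field equivalent: the equivalence relation is total (any two exact analogies are equivalent), so the on-shell classification of exact analogies by their far fields is empty (there is a single class).
   Context: Consider smooth solutions $q=(\rho,\boldsymbol u,p,\dots)$ on $\mathbb R^{1+d}$, $d\in\{2,3\}$, of the compressible Navier--Stokes equations $\partial_t\rho+\partial_j(\rho u_j)=0$, $\partial_t(\rho u_i)+\partial_j(\rho u_iu_j)+\partial_ip=\partial_j\sigma_{ij}$ (with an energy equation and equation of state), in a class with uniform state at spatial infinity and decaying fluctuations. An acoustic analogy is a triple $A=(L,\varphi,s)$ consisting of a linear differential operator $L$ that reduces to a d'Alembertian at spatial infinity, a map $\varphi$ from flow states to a scalar (or vector) wave variable whose far-field trace equals the normalised acoustic pressure fluctuation of the flow $q$, and a source functional $s$, such that $L\,\varphi(q)=s(q)$ identically on solutions $q$. It is exact if this holds without approximation. *)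

theory Defs
  imports "HOL-Analysis.Analysis"
begin

section \<open>Smooth fields on space-time\<close>

type_synonym 'd spacetime = "real \<times> (real ^ 'd)"

definition pd :: "'a::real_normed_vector \<Rightarrow> ('a \<Rightarrow> 'b::real_normed_vector) \<Rightarrow> 'a \<Rightarrow> 'b" where
  "pd v f = (\<lambda>z. frechet_derivative f (at z) v)"

abbreviation e_t :: "'d::finite spacetime" where "e_t \<equiv> (1, 0)"
abbreviation e_x :: "'d::finite \<Rightarrow> 'd spacetime" where "e_x i \<equiv> (0, axis i 1)"

abbreviation dt :: "('d::finite spacetime \<Rightarrow> 'b::real_normed_vector) \<Rightarrow> 'd spacetime \<Rightarrow> 'b" where
  "dt \<equiv> pd e_t"
abbreviation dx :: "'d::finite \<Rightarrow> ('d spacetime \<Rightarrow> 'b::real_normed_vector) \<Rightarrow> 'd spacetime \<Rightarrow> 'b" where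
  "dx i \<equiv> pd (e_x i)"

text \<open>Only used for open \<open>S\<close> in finite-dimensional spaces, where it is the usual class of
  \<open>k\<close> times continuously differentiable functions.\<close>

primrec Ck_on :: "nat \<Rightarrow> 'a::real_normed_vector set \<Rightarrow> ('a \<Rightarrow> 'b::real_normed_vector) \<Rightarrow> bool" where
  "Ck_on 0 S f \<longleftrightarrow> continuous_on S f"
| "Ck_on (Suc k) S f \<longleftrightarrow> f differentiable_on S \<and> (\<forall>v. Ck_on k S (pd v f))"

definition smooth_on :: "'a::real_normed_vector set \<Rightarrow> ('a \<Rightarrow> 'b::real_normed_vector) \<Rightarrow> bool" where
  "smooth_on S f \<longleftrightarrow> (\<forall>k. Ck_on k S f)"

abbreviation smooth :: "('a::real_normed_vector \<Rightarrow> 'b::real_normed_vector) \<Rightarrow> bool" where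
  "smooth \<equiv> smooth_on UNIV"


section \<open>The compressible Navier--Stokes equations\<close>

text \<open>All material laws are functions of density and temperature; \<open>lame_visc\<close> is the
  coefficient of the dilatation in the Newtonian stress.\<close>

record medium =
  pressure_law :: "real \<Rightarrow> real \<Rightarrow> real"
  energy_law :: "real \<Rightarrow> real \<Rightarrow> real"
  shear_visc :: "real \<Rightarrow> real \<Rightarrow> real"
  lame_visc :: "real \<Rightarrow> real \<Rightarrow> real"
  heat_cond :: "real \<Rightarrow> real \<Rightarrow> real"

text \<open>The last clauses of the definition are the Gibbs compatibility condition
  \<open>\<rho>\<^sup>2 \<partial>e/\<partial>\<rho> = p - T \<partial>p/\<partial>T\<close>, thermodynamic stability, and
  the sign conditions on the transport coefficients (nonnegative bulk viscosity in dimension \<open>d\<close>).\<close>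

definition admissible_medium :: "nat \<Rightarrow> medium \<Rightarrow> bool" where
  "admissible_medium d M \<longleftrightarrow>
     (\<forall>f \<in> {pressure_law M, energy_law M, shear_visc M, lame_visc M, heat_cond M}.
        smooth_on ({0<..} \<times> {0<..}) (\<lambda>(r, T). f r T)) \<and>
     (\<forall>r > 0. \<forall>T > 0.
        r\<^sup>2 * deriv (\<lambda>r'. energy_law M r' T) r
          = pressure_law M r T - T * deriv (\<lambda>T'. pressure_law M r T') T \<and>
        deriv (\<lambda>r'. pressure_law M r' T) r > 0 \<and>
        deriv (\<lambda>T'. energy_law M r T') T > 0 \<and>
        shear_visc M r T > 0 \<and>
        lame_visc M r T + 2 / real d * shear_visc M r T \<ge> 0 \<and>
        heat_cond M r T \<ge> 0)"

text \<open>\<open>c\<^sup>2 = (\<partial>p/\<partial>\<rho>)\<^sub>s\<close>, the isentropic derivative, expressed in the variables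
  \<open>(\<rho>, T)\<close>.\<close>

definition sound_speed :: "medium \<Rightarrow> real \<Rightarrow> real \<Rightarrow> real" where
  "sound_speed M r T =
     sqrt (deriv (\<lambda>r'. pressure_law M r' T) r
       + T * (deriv (\<lambda>T'. pressure_law M r T') T)\<^sup>2
           / (r\<^sup>2 * deriv (\<lambda>T'. energy_law M r T') T))"

record 'd flow =
  rho :: "'d spacetime \<Rightarrow> real"
  vel :: "'d spacetime \<Rightarrow> real ^ 'd"
  pres :: "'d spacetime \<Rightarrow> real"
  temp :: "'d spacetime \<Rightarrow> real"

definition stress :: "medium \<Rightarrow> 'd::finite flow \<Rightarrow> 'd \<Rightarrow> 'd \<Rightarrow> 'd spacetime \<Rightarrow> real" where
  "stress M q i j = (\<lambda>z.
     shear_visc M (rho q z) (temp q z) * (dx j (\<lambda>y. vel q y $ i) z + dx i (\<lambda>y. vel q y $ j) z)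
     + (if i = j then lame_visc M (rho q z) (temp q z) * (\<Sum>k\<in>UNIV. dx k (\<lambda>y. vel q y $ k) z) else 0))"

definition total_energy :: "medium \<Rightarrow> 'd::finite flow \<Rightarrow> 'd spacetime \<Rightarrow> real" where
  "total_energy M q = (\<lambda>z. energy_law M (rho q z) (temp q z) + (norm (vel q z))\<^sup>2 / 2)"

definition mass_eq :: "'d::finite flow \<Rightarrow> bool" where
  "mass_eq q \<longleftrightarrow> (\<forall>z. dt (rho q) z + (\<Sum>j\<in>UNIV. dx j (\<lambda>y. rho q y * vel q y $ j) z) = 0)"

definition momentum_eq :: "medium \<Rightarrow> 'd::finite flow \<Rightarrow> bool" where
  "momentum_eq M q \<longleftrightarrow> (\<forall>z i.
     dt (\<lambda>y. rho q y * vel q y $ i) z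
     + (\<Sum>j\<in>UNIV. dx j (\<lambda>y. rho q y * vel q y $ i * vel q y $ j) z)
     + dx i (pres q) z
     = (\<Sum>j\<in>UNIV. dx j (stress M q i j) z))"

definition energy_eq :: "medium \<Rightarrow> 'd::finite flow \<Rightarrow> bool" where
  "energy_eq M q \<longleftrightarrow> (\<forall>z.
     dt (\<lambda>y. rho q y * total_energy M q y) z
     + (\<Sum>j\<in>UNIV. dx j (\<lambda>y. (rho q y * total_energy M q y + pres q y) * vel q y $ j) z)
     = (\<Sum>j\<in>UNIV. dx j (\<lambda>y. (\<Sum>i\<in>UNIV. stress M q i j y * vel q y $ i)
           + heat_cond M (rho q y) (temp q y) * dx j (temp q) y) z))"

definition state_eq :: "medium \<Rightarrow> 'd::finite flow \<Rightarrow> bool" where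
  "state_eq M q \<longleftrightarrow> (\<forall>z. pres q z = pressure_law M (rho q z) (temp q z))"

definition smooth_NS_solution :: "medium \<Rightarrow> 'd::finite flow \<Rightarrow> bool" where
  "smooth_NS_solution M q \<longleftrightarrow>
     smooth (rho q) \<and> smooth (vel q) \<and> smooth (pres q) \<and> smooth (temp q) \<and>
     (\<forall>z. rho q z > 0 \<and> temp q z > 0) \<and>
     mass_eq q \<and> momentum_eq M q \<and> energy_eq M q \<and> state_eq M q"


section \<open>The far field\<close>

text \<open>The uniform state at spatial infinity (a medium at rest), the reference pressure used to
  normalise acoustic pressure, and the amplitude law of the far field.  For geometric spreading,
  \<open>amp r = r powr (- (d - 1) / 2)\<close>, and the trace below is the Friedlander radiation field.
  The law is left open because viscous attenuation makes outgoing waves decay faster, in which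
  case the radiation field at the geometric rate vanishes.\<close>

record ambient =
  rho_inf :: real
  temp_inf :: real
  p_ref :: real
  amp :: "real \<Rightarrow> real"

definition admissible_ambient :: "ambient \<Rightarrow> bool" where
  "admissible_ambient E \<longleftrightarrow> rho_inf E > 0 \<and> temp_inf E > 0 \<and> p_ref E > 0 \<and>
     (\<forall>r > 0. amp E r > 0) \<and> (amp E \<longlongrightarrow> 0) at_top"

abbreviation p_inf :: "medium \<Rightarrow> ambient \<Rightarrow> real" where
  "p_inf M E \<equiv> pressure_law M (rho_inf E) (temp_inf E)"

abbreviation c_inf :: "medium \<Rightarrow> ambient \<Rightarrow> real" where
  "c_inf M E \<equiv> sound_speed M (rho_inf E) (temp_inf E)"

datatype (dead 'd::finite) wave =
    Scalar_Wave "'d spacetime \<Rightarrow> real"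
  | Vector_Wave "'d spacetime \<Rightarrow> real ^ 'd"

text \<open>Limit along outgoing rays at fixed retarded time \<open>\<tau> = t - r / c\<close> and direction \<open>\<theta>\<close>.
  The far-field trace of a vector variable is the amplitude \<open>F\<close> of the longitudinal wave
  \<open>F \<tau> \<theta> *\<^sub>R \<theta>\<close> it converges to.  Only the values of \<open>F\<close> at unit vectors \<open>\<theta>\<close> matter.\<close>

definition has_ray_limit ::
  "medium \<Rightarrow> ambient \<Rightarrow> ('d::finite spacetime \<Rightarrow> 'w::real_normed_vector) \<Rightarrow>
   (real \<Rightarrow> real ^ 'd \<Rightarrow> 'w) \<Rightarrow> bool" where
  "has_ray_limit M E \<psi> G \<longleftrightarrow> (\<forall>\<tau>. \<forall>\<theta> \<in> sphere 0 1.
     ((\<lambda>r. \<psi> (\<tau> + r / c_inf M E, r *\<^sub>R \<theta>) /\<^sub>R amp E r) \<longlongrightarrow> G \<tau> \<theta>) at_top)"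

fun has_far_field_trace ::
  "medium \<Rightarrow> ambient \<Rightarrow> 'd::finite wave \<Rightarrow> (real \<Rightarrow> real ^ 'd \<Rightarrow> real) \<Rightarrow> bool" where
  "has_far_field_trace M E (Scalar_Wave \<psi>) F \<longleftrightarrow> has_ray_limit M E \<psi> F"
| "has_far_field_trace M E (Vector_Wave \<psi>) F \<longleftrightarrow> has_ray_limit M E \<psi> (\<lambda>\<tau> \<theta>. F \<tau> \<theta> *\<^sub>R \<theta>)"

definition far_field_traces_coincide ::
  "medium \<Rightarrow> ambient \<Rightarrow> 'd::finite wave \<Rightarrow> 'd wave \<Rightarrow> bool" where
  "far_field_traces_coincide M E W1 W2 \<longleftrightarrow>
     (\<exists>F. has_far_field_trace M E W1 F \<and> has_far_field_trace M E W2 F)"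

definition acoustic_pressure ::
  "medium \<Rightarrow> ambient \<Rightarrow> 'd::finite flow \<Rightarrow> 'd spacetime \<Rightarrow> real" where
  "acoustic_pressure M E q = (\<lambda>z. (pres q z - p_inf M E) / p_ref E)"

definition uniform_at_infinity :: "medium \<Rightarrow> ambient \<Rightarrow> 'd::finite flow \<Rightarrow> bool" where
  "uniform_at_infinity M E q \<longleftrightarrow> (\<forall>t.
     ((\<lambda>x. rho q (t, x)) \<longlongrightarrow> rho_inf E) at_infinity \<and>
     ((\<lambda>x. vel q (t, x)) \<longlongrightarrow> 0) at_infinity \<and>
     ((\<lambda>x. pres q (t, x)) \<longlongrightarrow> p_inf M E) at_infinity \<and>
     ((\<lambda>x. temp q (t, x)) \<longlongrightarrow> temp_inf E) at_infinity)"

text \<open>A class may impose further decay or regularity; every subclass of the one described by these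
  conditions is allowed.\<close>

definition flow_class :: "medium \<Rightarrow> ambient \<Rightarrow> 'd::finite flow set \<Rightarrow> bool" where
  "flow_class M E Q \<longleftrightarrow> (\<forall>q \<in> Q.
     smooth_NS_solution M q \<and> uniform_at_infinity M E q \<and>
     (\<exists>F. has_far_field_trace M E (Scalar_Wave (acoustic_pressure M E q)) F))"


section \<open>Acoustic analogies\<close>

text \<open>Iterated partial derivatives are indexed by words over the coordinate directions, so a
  coefficient family \<open>C\<close> of an operator is determined only up to reordering of its indices.
  The coefficients are linear maps on the values of the field, i.e. matrices in the vector case.\<close>

definition diff_op_repr ::
  "nat \<Rightarrow> ('d::finite spacetime list \<Rightarrow> 'd spacetime \<Rightarrow> 'w \<Rightarrow>\<^sub>L 'w) \<Rightarrow>
   (('d spacetime \<Rightarrow> 'w::euclidean_space) \<Rightarrow> ('d spacetime \<Rightarrow> 'w)) \<Rightarrow> bool" where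
  "diff_op_repr k C L \<longleftrightarrow>
     (\<forall>w. smooth (C w)) \<and>
     (\<forall>\<psi>. smooth \<psi> \<longrightarrow>
        L \<psi> = (\<lambda>z. \<Sum>w | set w \<subseteq> Basis \<and> length w \<le> k. blinfun_apply (C w z) (foldr pd w \<psi> z)))"

text \<open>Coefficients of \<open>c\<^sup>-\<^sup>2 \<partial>\<^sub>t\<^sup>2 - \<Delta>\<close>.\<close>

definition dalembert_coeff :: "real \<Rightarrow> 'd::finite spacetime list \<Rightarrow> real" where
  "dalembert_coeff c w =
     (if w = [e_t, e_t] then 1 / c\<^sup>2 else if \<exists>i. w = [e_x i, e_x i] then - 1 else 0)"

text \<open>The nonzero factor \<open>m\<close> admits any normalisation of the d'Alembertian, such as
  \<open>\<partial>\<^sub>t\<^sup>2 - c\<^sup>2 \<Delta>\<close>.\<close>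

definition wave_operator ::
  "real \<Rightarrow> (('d::finite spacetime \<Rightarrow> 'w::euclidean_space) \<Rightarrow> ('d spacetime \<Rightarrow> 'w)) \<Rightarrow> bool" where
  "wave_operator c L \<longleftrightarrow> (\<exists>k C m. diff_op_repr k C L \<and> 2 \<le> k \<and> m \<noteq> 0 \<and>
     (\<forall>w t. set w \<subseteq> Basis \<and> length w \<le> k \<longrightarrow>
        ((\<lambda>x. C w (t, x)) \<longlongrightarrow> (m * dalembert_coeff c w) *\<^sub>R id_blinfun) at_infinity))"

text \<open>A triple \<open>(L, \<phi>, s)\<close> with scalar or with vector wave variable.  The linear operator may have
  coefficients depending on the flow, as the convected wave operators of Phillips, Howe or Moehring
  do; an operator independent of the flow is the special case of a constant \<open>L\<close>.\<close>

datatype (dead 'd::finite) analogy =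
    Scalar_Analogy
      "'d flow \<Rightarrow> ('d spacetime \<Rightarrow> real) \<Rightarrow> ('d spacetime \<Rightarrow> real)"
      "'d flow \<Rightarrow> 'd spacetime \<Rightarrow> real"
      "'d flow \<Rightarrow> 'd spacetime \<Rightarrow> real"
  | Vector_Analogy
      "'d flow \<Rightarrow> ('d spacetime \<Rightarrow> real ^ 'd) \<Rightarrow> ('d spacetime \<Rightarrow> real ^ 'd)"
      "'d flow \<Rightarrow> 'd spacetime \<Rightarrow> real ^ 'd"
      "'d flow \<Rightarrow> 'd spacetime \<Rightarrow> real ^ 'd"

fun wave_variable :: "'d::finite analogy \<Rightarrow> 'd flow \<Rightarrow> 'd wave" where
  "wave_variable (Scalar_Analogy L \<phi> s) q = Scalar_Wave (\<phi> q)"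
| "wave_variable (Vector_Analogy L \<phi> s) q = Vector_Wave (\<phi> q)"

definition satisfies_wave_equation ::
  "real \<Rightarrow> 'd::finite flow \<Rightarrow>
   ('d flow \<Rightarrow> ('d spacetime \<Rightarrow> 'w::euclidean_space) \<Rightarrow> ('d spacetime \<Rightarrow> 'w)) \<Rightarrow>
   ('d flow \<Rightarrow> 'd spacetime \<Rightarrow> 'w) \<Rightarrow> ('d flow \<Rightarrow> 'd spacetime \<Rightarrow> 'w) \<Rightarrow> bool" where
  "satisfies_wave_equation c q L \<phi> s \<longleftrightarrow>
     wave_operator c (L q) \<and> smooth (\<phi> q) \<and> (\<forall>z. L q (\<phi> q) z = s q z)"

fun satisfied_by :: "real \<Rightarrow> 'd::finite flow \<Rightarrow> 'd analogy \<Rightarrow> bool" where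
  "satisfied_by c q (Scalar_Analogy L \<phi> s) \<longleftrightarrow> satisfies_wave_equation c q L \<phi> s"
| "satisfied_by c q (Vector_Analogy L \<phi> s) \<longleftrightarrow> satisfies_wave_equation c q L \<phi> s"

definition exact_analogies :: "medium \<Rightarrow> ambient \<Rightarrow> 'd::finite flow set \<Rightarrow> 'd analogy set" where
  "exact_analogies M E Q = {A. \<forall>q \<in> Q.
     satisfied_by (c_inf M E) q A \<and>
     far_field_traces_coincide M E (wave_variable A q) (Scalar_Wave (acoustic_pressure M E q))}"

definition far_field_equivalent ::
  "medium \<Rightarrow> ambient \<Rightarrow> 'd::finite flow set \<Rightarrow> 'd analogy \<Rightarrow> 'd analogy \<Rightarrow> bool" where
  "far_field_equivalent M E Q A1 A2 \<longleftrightarrow>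
     (\<forall>q \<in> Q. far_field_traces_coincide M E (wave_variable A1 q) (wave_variable A2 q))"

definition far_field_relation ::
  "medium \<Rightarrow> ambient \<Rightarrow> 'd::finite flow set \<Rightarrow> ('d analogy \<times> 'd analogy) set" where
  "far_field_relation M E Q =
     {(A1, A2). A1 \<in> exact_analogies M E Q \<and> A2 \<in> exact_analogies M E Q \<and>
        far_field_equivalent M E Q A1 A2}"

end

(* Every exact analogy has the trace of the acoustic pressure as its own trace.  Traces are limits
   along rays, hence unique, so any two exact analogies share one.  That there is exactly one class
   also needs an exact analogy to exist: the d'Alembertian acting on the acoustic pressure, with
   the result of this action as the source. *)

theory Submission
  imports Defs
begin

lemma pd_const: "pd v (\<lambda>_. a) = (\<lambda>_. 0)"
  by (simp add: pd_def)

lemma smooth_on_const: "smooth_on S (\<lambda>_. a)"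
proof -
  have "Ck_on k S (\<lambda>_. a)" for k
    by (induction k arbitrary: a) (simp_all add: pd_const)
  then show ?thesis
    by (simp add: smooth_on_def)
qed

text \<open>The subtracted \<open>0\<close> keeps the derivative in the shape
  \<open>(g z - a) / b\<close>, so that an induction on the order of differentiability can apply to
  it again.\<close>

lemma pd_affine:
  fixes f :: "'a::real_normed_vector \<Rightarrow> real"
  assumes "f differentiable_on UNIV"
  shows "pd v (\<lambda>z. (f z - a) / b) = (\<lambda>z. (pd v f z - 0) / b)"
proof
  fix z
  have "(f has_derivative frechet_derivative f (at z)) (at z)"
    using assms by (simp add: differentiable_on_def frechet_derivative_works)
  then have "((\<lambda>z. (f z - a) / b) has_derivative (\<lambda>h. (frechet_derivative f (at z) h - 0) / b)) (at z)"
    unfolding divide_inverse by (intro has_derivative_mult_left has_derivative_diff has_derivative_const)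
  then show "pd v (\<lambda>z. (f z - a) / b) z = (pd v f z - 0) / b"
    unfolding pd_def by (metis frechet_derivative_at)
qed

text \<open>\<open>acoustic_pressure\<close> has this form, with \<open>f\<close> the pressure of
  the flow.\<close>

lemma smooth_affine:
  fixes f :: "'a::real_normed_vector \<Rightarrow> real"
  assumes "smooth f"
  shows "smooth (\<lambda>z. (f z - a) / b)"
proof -
  have "Ck_on k UNIV (\<lambda>z. (f z - a) / b)" if "Ck_on k UNIV f" for k
    using that
  \<comment> \<open>One differentiation replaces \<open>f\<close> by \<open>pd v f\<close> and
    \<open>a\<close> by \<open>0\<close>, while \<open>b\<close> stays fixed.\<close>
  proof (induction k arbitrary: f a)
    case 0
    then show ?case
      by (simp add: divide_inverse continuous_on_mult_right continuous_on_diff)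
  next
    case (Suc k)
    then have f: "f differentiable_on UNIV"
      by simp
    moreover have "(\<lambda>z. (f z - a) / b) differentiable_on UNIV"
      using f unfolding divide_inverse differentiable_on_def
      by (intro ballI differentiable_mult differentiable_diff differentiable_const) auto
    ultimately show ?case
      using Suc by (simp only: Ck_on.simps pd_affine) blast
  qed
  then show ?thesis
    using assms by (simp add: smooth_on_def)
qed

text \<open>The sum over words copies the format of \<open>diff_op_repr\<close>, which makes the
  coefficients readable off the definition.\<close>

definition dalembertian ::
  "real \<Rightarrow> ('d::finite spacetime \<Rightarrow> 'w::euclidean_space) \<Rightarrow> ('d spacetime \<Rightarrow> 'w)" where
  "dalembertian c \<psi> =
     (\<lambda>z. \<Sum>w | set w \<subseteq> Basis \<and> length w \<le> 2. dalembert_coeff c w *\<^sub>R foldr pd w \<psi> z)"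

lemma wave_operator_dalembertian: "wave_operator c (dalembertian c)"
  unfolding wave_operator_def
proof (intro exI conjI allI impI)
  \<comment> \<open>The coefficients are constant in space and time, so they equal their limits at
    infinity, with \<open>m = 1\<close>.\<close>
  show "diff_op_repr 2 (\<lambda>w _. dalembert_coeff c w *\<^sub>R id_blinfun) (dalembertian c)"
    by (simp add: diff_op_repr_def smooth_on_const dalembertian_def scaleR_blinfun.rep_eq)
  show "((\<lambda>x. dalembert_coeff c w *\<^sub>R id_blinfun) \<longlongrightarrow> (1 * dalembert_coeff c w) *\<^sub>R id_blinfun) at_infinity"
    for w :: "'a spacetime list"
    by simp
qed auto

lemma exact_analogies_nonempty:
  assumes "flow_class M E Q"
  shows "exact_analogies M E Q \<noteq> {}"
proof -
  let ?L = "dalembertian (c_inf M E)" and ?\<phi> = "acoustic_pressure M E"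
  have "satisfied_by (c_inf M E) q (Scalar_Analogy (\<lambda>_. ?L) ?\<phi> (\<lambda>q. ?L (?\<phi> q)))" if "q \<in> Q" for q
  proof -
    have "smooth (pres q)"
      using assms that by (auto simp: flow_class_def smooth_NS_solution_def)
    then have "smooth (?\<phi> q)"
      unfolding acoustic_pressure_def by (rule smooth_affine)
    then show ?thesis
      by (simp add: satisfies_wave_equation_def wave_operator_dalembertian)
  qed
  \<comment> \<open>This is more than reflexivity: coinciding includes the existence of a trace,
    which \<open>flow_class\<close> provides.\<close>
  moreover have "far_field_traces_coincide M E (Scalar_Wave (?\<phi> q)) (Scalar_Wave (?\<phi> q))"
    if "q \<in> Q" for q
    using assms that by (auto simp: flow_class_def far_field_traces_coincide_def)
  ultimately have "Scalar_Analogy (\<lambda>_. ?L) ?\<phi> (\<lambda>q. ?L (?\<phi> q)) \<in> exact_analogies M E Q"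
    by (simp add: exact_analogies_def)
  then show ?thesis
    by blast
qed

lemma has_ray_limit_unique:
  assumes "has_ray_limit M E \<psi> F" "has_ray_limit M E \<psi> G" "\<theta> \<in> sphere 0 1"
  shows "F \<tau> \<theta> = G \<tau> \<theta>"
  using assms unfolding has_ray_limit_def
  by (meson tendsto_unique trivial_limit_at_top_linorder)

text \<open>Uniqueness of ray limits identifies traces at unit vectors only; this bridges the gap to
  equality of functions.\<close>

lemma has_far_field_trace_cong:
  assumes "has_far_field_trace M E W F" "\<And>\<tau> \<theta>. \<theta> \<in> sphere 0 1 \<Longrightarrow> F \<tau> \<theta> = G \<tau> \<theta>"
  shows "has_far_field_trace M E W G"
  using assms by (cases W) (simp_all add: has_ray_limit_def)

text \<open>Transitivity holds because the middle wave has only one trace on unit directions. A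
  scalar middle wave suffices, since it will be the acoustic pressure; \<open>W1\<close> and
  \<open>W2\<close> may each be scalar or vector.\<close>

lemma far_field_traces_coincide_via_scalar:
  assumes "far_field_traces_coincide M E W1 (Scalar_Wave \<psi>)"
    and "far_field_traces_coincide M E W2 (Scalar_Wave \<psi>)"
  shows "far_field_traces_coincide M E W1 W2"
proof -
  obtain F where F: "has_far_field_trace M E W1 F" "has_ray_limit M E \<psi> F"
    using assms(1) by (auto simp: far_field_traces_coincide_def)
  obtain G where G: "has_far_field_trace M E W2 G" "has_ray_limit M E \<psi> G"
    using assms(2) by (auto simp: far_field_traces_coincide_def)
  have "has_far_field_trace M E W1 G"
    using F(1) has_ray_limit_unique[OF F(2) G(2)] by (rule has_far_field_trace_cong)
  with G(1) show ?thesis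
    by (auto simp: far_field_traces_coincide_def)
qed

lemma exact_analogies_equivalent:
  assumes "A1 \<in> exact_analogies M E Q" "A2 \<in> exact_analogies M E Q"
  shows "far_field_equivalent M E Q A1 A2"
  using assms
  by (auto simp: exact_analogies_def far_field_equivalent_def
      intro: far_field_traces_coincide_via_scalar)

theorem proposition2:
  fixes M :: medium and E :: ambient and Q :: "'d::finite flow set"
  assumes "CARD('d) \<in> {2, 3}"
    and "admissible_medium CARD('d) M"
    and "admissible_ambient E"
    and "flow_class M E Q"
  shows "equiv (exact_analogies M E Q) (far_field_relation M E Q)
    \<and> (\<forall>A1 \<in> exact_analogies M E Q. \<forall>A2 \<in> exact_analogies M E Q. far_field_equivalent M E Q A1 A2)
    \<and> exact_analogies M E Q // far_field_relation M E Q = {exact_analogies M E Q}"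
proof -
  let ?X = "exact_analogies M E Q"
  \<comment> \<open>Totality turns the relation into the full square of \<open>?X\<close>.\<close>
  have rel: "far_field_relation M E Q = ?X \<times> ?X"
    by (auto simp: far_field_relation_def exact_analogies_equivalent)
  have "equiv ?X (?X \<times> ?X)"
    by (auto simp: equiv_def refl_on_def sym_def trans_def)
  \<comment> \<open>Nonemptiness matters here: the quotient of the empty set has no classes at
    all.\<close>
  moreover have "?X // (?X \<times> ?X) = {?X}"
    using exact_analogies_nonempty[OF assms(4)] by (auto simp: quotient_def)
  ultimately show ?thesis
    by (simp add: rel exact_analogies_equivalent)
qed

end
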